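(* Let $\varrho=X(a,b,c)$ be a three qubit X-state, with $a,b\in\mathbb R^4$ and $c\in\mathbb C^4$. Then $\varrho$ is separable if and only if the inequality $$C(z)\,\Delta_\varrho\ \ge\ \mathcal L(\varrho,z)$$ holds for every $z\in\mathbb C^4$.
   Context: For $a,b\in\mathbb R^4$ and $c\in\mathbb C^4$, $X(a,b,c)$ denotes the $8\times 8$ self-adjoint matrix, regarded as an element of $M_2\otimes M_2\otimes M_2$ (complex $2\times 2$ matrices, basis indices $000,001,\dots,111$ in lexicographic order), whose diagonal is $(a_1,a_2,a_3,a_4,b_4,b_3,b_2,b_1)$, whose anti-diagonal entries, read from the top-right corner to the bottom-left corner, are $(c_1,c_2,c_3,c_4,\bar c_4,\bar c_3,\bar c_2,\bar c_1)$, and all of whose other entries are zero. A (three qubit) state is a positive semidefinite matrix in $M_2\otimes M_2\otimes M_2$; normalization of the trace is irrelevant here and is disregarded. An X-state is a state of the form $X(a,b,c)$. A state is separable if it is a sum (equivalently, up to normalization, a convex combination) of pure product states, i.e. of rank one projections, up to positive scalars, onto product vectors $x\otimes y\otimes w$ with $x,y,w\in\mathbb C^2$. For $\varrho=X(a,b,c)$ and $z\in\mathbb C^4$, $$\Delta_\varrho=\min\{\sqrt{a_1b_1},\sqrt{a_2b_2},\sqrt{a_3b_3},\sqrt{a_4b_4},\sqrt[4]{a_1b_2b_3a_4},\sqrt[4]{b_1a_2a_3b_4}\},$$ $$\mathcal L(\varrho,z)=\mathrm{Re}\,(z_1c_1+z_2c_2+z_3c_3+z_4\bar c_4),$$ $$C(z)=\sup_{\alpha,\beta,\gamma\in\mathbb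 R}\big|\mathrm{Re}(z_1)\cos(\alpha+\beta+\gamma)-\mathrm{Im}(z_1)\sin(\alpha+\beta+\gamma)+\mathrm{Re}(z_2)\cos\alpha-\mathrm{Im}(z_2)\sin\alpha+\mathrm{Re}(z_3)\cos\beta-\mathrm{Im}(z_3)\sin\beta+\mathrm{Re}(z_4)\cos\gamma-\mathrm{Im}(z_4)\sin\gamma\big|.$$ *)

theory Defs
  imports "HOL-Analysis.Analysis"
begin

text \<open>
  The space \<open>M\<^sub>2 \<otimes> M\<^sub>2 \<otimes> M\<^sub>2\<close> is rendered as the complex square matrices whose rows and columns
  are indexed by triples over the two-element type \<open>2 = {0, 1}\<close>.
\<close>

type_synonym qubit3 = "2 \<times> 2 \<times> 2"
type_synonym cvec8 = "complex ^ qubit3"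
type_synonym cmat8 = "complex ^ qubit3 ^ qubit3"

definition lex_pos :: "qubit3 \<Rightarrow> nat" where
  "lex_pos p = (case p of (i, j, k) \<Rightarrow> 4 * of_bool (i = 1) + 2 * of_bool (j = 1) + of_bool (k = 1))"

definition X_matrix :: "real ^ 4 \<Rightarrow> real ^ 4 \<Rightarrow> complex ^ 4 \<Rightarrow> cmat8" where
  "X_matrix a b c = (\<chi> p q.
     if lex_pos q = lex_pos p then
       complex_of_real ([a $ 1, a $ 2, a $ 3, a $ 4, b $ 4, b $ 3, b $ 2, b $ 1] ! lex_pos p)
     else if lex_pos q = 7 - lex_pos p then
       [c $ 1, c $ 2, c $ 3, c $ 4, cnj (c $ 4), cnj (c $ 3), cnj (c $ 2), cnj (c $ 1)] ! lex_pos p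
     else 0)"

definition self_adjoint :: "complex ^ 'n ^ 'n \<Rightarrow> bool" where
  "self_adjoint A \<longleftrightarrow> (\<forall>p q. A $ q $ p = cnj (A $ p $ q))"

definition positive_semidefinite :: "complex ^ 'n ^ 'n \<Rightarrow> bool" where
  "positive_semidefinite A \<longleftrightarrow>
     self_adjoint A \<and> (\<forall>v. 0 \<le> Re (\<Sum>p\<in>UNIV. cnj (v $ p) * (A *v v) $ p))"

text \<open>States are not normalized; in particular the zero matrix counts as a state.\<close>

definition three_qubit_state :: "cmat8 \<Rightarrow> bool" where
  "three_qubit_state \<rho> \<longleftrightarrow> positive_semidefinite \<rho>"

definition tensor3 :: "complex ^ 2 \<Rightarrow> complex ^ 2 \<Rightarrow> complex ^ 2 \<Rightarrow> cvec8" where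
  "tensor3 x y w = (\<chi> p. case p of (i, j, k) \<Rightarrow> x $ i * y $ j * w $ k)"

text \<open>For a unit vector \<open>v\<close>, this is the orthogonal projection onto the line spanned by \<open>v\<close>.\<close>

definition rank_one :: "complex ^ 'n \<Rightarrow> complex ^ 'n ^ 'n" where
  "rank_one v = (\<chi> p q. v $ p * cnj (v $ q))"

definition pure_product_state :: "cmat8 \<Rightarrow> bool" where
  "pure_product_state A \<longleftrightarrow>
     (\<exists>r x y w. r > 0 \<and> norm (tensor3 x y w) = 1 \<and> A = r *\<^sub>R rank_one (tensor3 x y w))"

text \<open>The empty sum is allowed, so the zero state is separable.\<close>

definition separable_state :: "cmat8 \<Rightarrow> bool" where
  "separable_state \<rho> \<longleftrightarrow>
     (\<exists>(n::nat) A. (\<forall>l<n. pure_product_state (A l)) \<and> \<rho> = (\<Sum>l<n. A l))"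

definition Delta_X :: "real ^ 4 \<Rightarrow> real ^ 4 \<Rightarrow> real" where
  "Delta_X a b = Min {sqrt (a $ 1 * b $ 1), sqrt (a $ 2 * b $ 2),
                      sqrt (a $ 3 * b $ 3), sqrt (a $ 4 * b $ 4),
                      root 4 (a $ 1 * b $ 2 * b $ 3 * a $ 4),
                      root 4 (b $ 1 * a $ 2 * a $ 3 * b $ 4)}"

definition L_X :: "complex ^ 4 \<Rightarrow> complex ^ 4 \<Rightarrow> real" where
  "L_X c z = Re (z $ 1 * c $ 1 + z $ 2 * c $ 2 + z $ 3 * c $ 3 + z $ 4 * cnj (c $ 4))"

definition C_fun :: "complex ^ 4 \<Rightarrow> real" where
  "C_fun z = (SUP (\<alpha>, \<beta>, \<gamma>) \<in> (UNIV :: (real \<times> real \<times> real) set).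
     \<bar>Re (z $ 1) * cos (\<alpha> + \<beta> + \<gamma>) - Im (z $ 1) * sin (\<alpha> + \<beta> + \<gamma>)
      + Re (z $ 2) * cos \<alpha> - Im (z $ 2) * sin \<alpha>
      + Re (z $ 3) * cos \<beta> - Im (z $ 3) * sin \<beta>
      + Re (z $ 4) * cos \<gamma> - Im (z $ 4) * sin \<gamma>\<bar>)"

end

theory Submission
  imports Defs
begin

text \<open>
  A product vector contributes \<open>s t\<close> to the antidiagonal, where \<open>t\<close> lies on the three-torus
  \<open>(cis (\<alpha> + \<beta> + \<gamma>), cis \<alpha>, cis \<beta>, cis (- \<gamma>))\<close> and \<open>s\<close> is the common modulus; the Cauchy-Schwarz
  inequality and its four-term version bound the sum of these \<open>s\<close> by \<open>\<Delta>\<close>, while \<open>C z\<close> bounds the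
  functional \<open>\<L>(\<cdot>, z)\<close> on the torus. Conversely, the inequalities say by Hahn-Banach separation that
  \<open>c\<close> lies in the convex hull of \<open>\<Delta>\<close> times the torus, and separable states form a convex cone, so
  only \<open>c = \<Delta> t\<close> matters. There the diagonal can be shrunk until all the inequalities behind
  \<open>\<Delta>\<close> are equalities; the diagonal then is that of a product vector, and averaging the product
  state over sign changes kills the entries off the two diagonals.
\<close>

section \<open>Index triples and real-linearity of X-matrices\<close>

lemma bit_cases: "(i::2) = 0 \<or> i = 1"
  using exhaust_2[of i] by auto

lemma qubit_cases: "(p::qubit3) \<in> {(0,0,0),(0,0,1),(0,1,0),(0,1,1),(1,0,0),(1,0,1),(1,1,0),(1,1,1)}"
proof -
  obtain i j k where p: "p = (i, j, k)" by (cases p)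
  show ?thesis
    unfolding p using bit_cases[of i] bit_cases[of j] bit_cases[of k] by (elim disjE) simp_all
qed

lemma lex_pos_cases: "lex_pos p \<in> {0, 1, 2, 3, 4, 5, 6, 7}"
  using qubit_cases[of p] by (elim insertE emptyE; simp add: lex_pos_def)

lemma X_matrix_add: "X_matrix a b c + X_matrix a' b' c' = X_matrix (a + a') (b + b') (c + c')"
proof -
  have "(X_matrix a b c + X_matrix a' b' c') $ p $ q = X_matrix (a + a') (b + b') (c + c') $ p $ q" for p q
    using lex_pos_cases[of p] by (elim insertE emptyE; simp add: X_matrix_def)
  then show ?thesis by (simp add: vec_eq_iff)
qed

text \<open>The scalar is real because the lower half of the antidiagonal conjugates
  \<open>c\<close>, so that \<open>c\<close> enters only real-linearly.\<close>

lemma X_matrix_scaleR: "k *\<^sub>R X_matrix a b c = X_matrix (k *\<^sub>R a) (k *\<^sub>R b) (k *\<^sub>R c)"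
proof -
  have "(k *\<^sub>R X_matrix a b c) $ p $ q = X_matrix (k *\<^sub>R a) (k *\<^sub>R b) (k *\<^sub>R c) $ p $ q" for p q
    using lex_pos_cases[of p] by (elim insertE emptyE; simp add: X_matrix_def scaleR_conv_of_real[where 'a = complex])
  then show ?thesis by (simp add: vec_eq_iff)
qed

section \<open>The convex cone of separable states\<close>

lemma separable_stateI:
  fixes n :: nat
  assumes "\<And>l. l < n \<Longrightarrow> pure_product_state (A l)" "\<rho> = (\<Sum>l<n. A l)"
  shows "separable_state \<rho>"
  unfolding separable_state_def using assms by (intro exI[of _ n] exI[of _ A]) simp

lemma separable_stateE:
  assumes "separable_state \<rho>"
  obtains n :: nat and A where "\<forall>l<n. pure_product_state (A l)" "\<rho> = (\<Sum>l<n. A l)"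
  using assms(1) unfolding separable_state_def by (elim exE conjE) (rule that)

lemma pure_product_stateI:
  assumes "r > 0" "norm (tensor3 x y w) = 1" "A = r *\<^sub>R rank_one (tensor3 x y w)"
  shows "pure_product_state A"
  unfolding pure_product_state_def using assms
  by (intro exI[of _ r] exI[of _ x] exI[of _ y] exI[of _ w]) simp

lemma pure_product_stateE:
  assumes "pure_product_state A"
  obtains r x y w where "r > 0" "norm (tensor3 x y w) = 1" "A = r *\<^sub>R rank_one (tensor3 x y w)"
  using assms(1) unfolding pure_product_state_def by (elim exE conjE) (rule that)

lemma separable_zero: "separable_state 0"
  by (rule separable_stateI[of 0 "\<lambda>_. 0"]) simp_all

lemma separable_add:
  assumes "separable_state \<rho>" "separable_state \<sigma>"
  shows "separable_state (\<rho> + \<sigma>)"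
proof -
  obtain n :: nat and A where A: "\<forall>l<n. pure_product_state (A l)" "\<rho> = (\<Sum>l<n. A l)"
    using assms(1) by (rule separable_stateE)
  obtain m :: nat and B where B: "\<forall>l<m. pure_product_state (B l)" "\<sigma> = (\<Sum>l<m. B l)"
    using assms(2) by (rule separable_stateE)
  define D where "D l = (if l < n then A l else B (l - n))" for l :: nat
  have "(\<Sum>l<n + m. D l) = (\<Sum>l<n. D l) + (\<Sum>l<m. D (n + l))"
    by (induction m) (simp_all add: add.assoc)
  then have "\<rho> + \<sigma> = (\<Sum>l<n + m. D l)"
    by (simp add: A(2) B(2) D_def)
  moreover have "pure_product_state (D l)" if "l < n + m" for l
    using A(1) B(1) that by (simp add: D_def)
  ultimately show ?thesis
    by (intro separable_stateI[of "n + m" D])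
qed

lemma separable_scaleR:
  assumes "separable_state \<rho>" "k \<ge> 0"
  shows "separable_state (k *\<^sub>R \<rho>)"
proof (cases "k = 0")
  case True
  then show ?thesis by (simp add: separable_zero)
next
  case False
  obtain n :: nat and A where A: "\<forall>l<n. pure_product_state (A l)" "\<rho> = (\<Sum>l<n. A l)"
    using assms(1) by (rule separable_stateE)
  have "pure_product_state (k *\<^sub>R A l)" if l: "l < n" for l
  proof -
    obtain r x y w where "r > 0" "norm (tensor3 x y w) = 1" "A l = r *\<^sub>R rank_one (tensor3 x y w)"
      using A(1)[rule_format, OF l] by (rule pure_product_stateE)
    then show ?thesis
      using assms(2) False by (intro pure_product_stateI[of "k * r"]) simp_all
  qed
  then show ?thesis
    by (intro separable_stateI[of n "\<lambda>l. k *\<^sub>R A l"]) (simp_all add: A(2) scaleR_right.sum)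
qed

text \<open>Frees later constructions from the unit norm in \<open>pure_product_state\<close>: the
  norm is moved into the first factor and its square becomes the weight. The zero vector gives the
  empty sum.\<close>

lemma separable_rank_one_tensor3: "separable_state (rank_one (tensor3 x y w))"
proof (cases "tensor3 x y w = 0")
  case True
  then have "rank_one (tensor3 x y w) = 0" by (simp add: rank_one_def vec_eq_iff)
  then show ?thesis by (simp add: separable_zero)
next
  case False
  define k where "k = norm (tensor3 x y w)"
  have k: "k > 0" using False by (simp add: k_def)
  have eq: "tensor3 (inverse k *\<^sub>R x) y w = inverse k *\<^sub>R tensor3 x y w"
    by (simp add: tensor3_def vec_eq_iff)
  have scale: "rank_one (s *\<^sub>R v) = s\<^sup>2 *\<^sub>R rank_one v" for s and v :: cvec8
    by (simp add: rank_one_def vec_eq_iff power2_eq_square)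
  have "norm (tensor3 (inverse k *\<^sub>R x) y w) = 1"
    using k unfolding eq by (simp add: k_def)
  moreover have "rank_one (tensor3 x y w) = k\<^sup>2 *\<^sub>R rank_one (tensor3 (inverse k *\<^sub>R x) y w)"
    using k unfolding eq scale by (simp add: field_simps)
  ultimately have "pure_product_state (rank_one (tensor3 x y w))"
    using k by (intro pure_product_stateI[of "k\<^sup>2" "inverse k *\<^sub>R x" y w]) simp_all
  then show ?thesis
    by (intro separable_stateI[of 1 "\<lambda>_. rank_one (tensor3 x y w)"]) simp_all
qed

section \<open>Explicit separable X-matrices\<close>

definition qubit :: "complex \<Rightarrow> complex \<Rightarrow> complex ^ 2" where
  "qubit s t = (\<chi> i. if i = 0 then s else t)"

lemma rank_one_tensor3:
  "rank_one (tensor3 x y w) $ (i, j, k) $ (i', j', k') =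
    (x $ i * cnj (x $ i')) * (y $ j * cnj (y $ j')) * (w $ k * cnj (w $ k'))"
  by (simp add: rank_one_def tensor3_def)

lemma vector_4:
  "(vector [s, t, u, v] :: 'a::zero ^ 4) $ 1 = s"
  "(vector [s, t, u, v] :: 'a::zero ^ 4) $ 2 = t"
  "(vector [s, t, u, v] :: 'a::zero ^ 4) $ 3 = u"
  "(vector [s, t, u, v] :: 'a::zero ^ 4) $ 4 = v"
  by (simp_all add: vector_def)

lemma separable_X_diagonal:
  fixes a b :: "real ^ 4"
  assumes "\<And>i. a $ i \<ge> 0" "\<And>i. b $ i \<ge> 0"
  shows "separable_state (X_matrix a b 0)"
proof -
  define E where "E i j k = rank_one (tensor3 (axis i 1) (axis j 1) (axis k 1))" for i j k :: 2
  have "X_matrix a b 0 =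
      (a$1) *\<^sub>R E 0 0 0 + (a$2) *\<^sub>R E 0 0 1 + (a$3) *\<^sub>R E 0 1 0 + (a$4) *\<^sub>R E 0 1 1 +
      (b$4) *\<^sub>R E 1 0 0 + (b$3) *\<^sub>R E 1 0 1 + (b$2) *\<^sub>R E 1 1 0 + (b$1) *\<^sub>R E 1 1 1" (is "_ = ?D")
  proof -
    have "X_matrix a b 0 $ p $ q = ?D $ p $ q" for p q
      using qubit_cases[of p] qubit_cases[of q]
      by (auto simp: X_matrix_def lex_pos_def E_def rank_one_def tensor3_def axis_def scaleR_conv_of_real[where 'a = complex])
    then show ?thesis by (simp add: vec_eq_iff)
  qed
  moreover have "separable_state (E i j k)" for i j k
    unfolding E_def by (rule separable_rank_one_tensor3)
  ultimately show ?thesis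
    using assms by (simp add: separable_add separable_scaleR)
qed

text \<open>This is the diagonal of the product of three vectors with moduli
  \<open>(exp (s / 2), exp (- s / 2))\<close>, for s = x, y, w. In each factor the two moduli
  multiply to 1, so every antidiagonal entry is a pure phase, and all six quantities in the minimum
  defining \<open>Delta_X\<close> equal 1.\<close>

lemma separable_X_geometric:
  fixes x y w \<theta> \<phi> \<psi> :: real
  shows "separable_state (X_matrix
     (vector [exp (x + y + w), exp (x + y - w), exp (x - y + w), exp (x - y - w)])
     (vector [exp (- x - y - w), exp (- x - y + w), exp (- x + y - w), exp (- x + y + w)])
     (vector [cis (\<theta> + \<phi> + \<psi>), cis (\<theta> + \<phi> - \<psi>), cis (\<theta> - \<phi> + \<psi>), cis (\<theta> - \<phi> - \<psi>)]))"
    (is "separable_state ?X")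
proof -
  define v where "v e t s = qubit (e * of_real (exp (s / 2)) * cis t) (of_real (exp (- s / 2)))"
    for e :: complex and t s :: real
  \<comment> \<open>The three signs have product 1, which keeps the antidiagonal and, after averaging, leaves nothing else off the diagonal.\<close>
  define R where "R e f = rank_one (tensor3 (v e \<theta> x) (v f \<phi> y) (v (e * f) \<psi> w))" for e f
  have exp2: "exp (s / 2) * exp (s / 2) = exp s" "exp (- (s / 2)) * exp (- (s / 2)) = exp (- s)"
    "exp (s / 2) * exp (- (s / 2)) = 1" "exp (- (s / 2)) * exp (s / 2) = 1" for s :: real
    by (simp_all flip: exp_add)
  have cexp2: "complex_of_real (exp (s / 2)) * of_real (exp (s / 2)) = of_real (exp s)"
    "complex_of_real (exp (- (s / 2))) * of_real (exp (- (s / 2))) = of_real (exp (- s))"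
    "complex_of_real (exp (s / 2)) * of_real (exp (- (s / 2))) = 1"
    "complex_of_real (exp (- (s / 2))) * of_real (exp (s / 2)) = 1" for s :: real
    by (simp_all only: exp2 flip: of_real_mult) simp_all
  have v: "v e t s $ i * cnj (v e t s $ j) =
     (if i = 0 then if j = 0 then of_real (exp s) else e * cis t
      else if j = 0 then e * cis (- t) else of_real (exp (- s)))" if "e * e = 1" "cnj e = e" for e t s i j
    using that cexp2[of s]
    by (auto simp: v_def qubit_def cis_cnj cis_mult algebra_simps)
  have R: "R e f $ (i, j, k) $ (i', j', k') =
      (if i = 0 then if i' = 0 then of_real (exp x) else e * cis \<theta>
       else if i' = 0 then e * cis (- \<theta>) else of_real (exp (- x))) *
      (if j = 0 then if j' = 0 then of_real (exp y) else f * cis \<phi>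
       else if j' = 0 then f * cis (- \<phi>) else of_real (exp (- y))) *
      (if k = 0 then if k' = 0 then of_real (exp w) else e * f * cis \<psi>
       else if k' = 0 then e * f * cis (- \<psi>) else of_real (exp (- w)))"
    if "e \<in> {1, - 1}" "f \<in> {1, - 1}" for e f i j k i' j' k'
  proof -
    have "e * e = 1" "cnj e = e" "f * f = 1" "cnj f = f" "(e * f) * (e * f) = 1" "cnj (e * f) = e * f"
      using that by auto
    then show ?thesis
      unfolding R_def rank_one_tensor3 by (simp only: v)
  qed
  have S: "((1 / 4) *\<^sub>R (R 1 1 + R 1 (- 1) + R (- 1) 1 + R (- 1) (- 1))) $ p $ q =
     (R 1 1 $ p $ q + R 1 (- 1) $ p $ q + R (- 1) 1 $ p $ q + R (- 1) (- 1) $ p $ q) / 4" for p q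
    by (simp add: scaleR_conv_of_real[where 'a = complex])
  have "?X $ p $ q = ((1 / 4) *\<^sub>R (R 1 1 + R 1 (- 1) + R (- 1) 1 + R (- 1) (- 1))) $ p $ q" for p q
    unfolding S using qubit_cases[of p] qubit_cases[of q]
    by (elim insertE emptyE; simp add: R X_matrix_def lex_pos_def vector_4 cis_mult cis_cnj flip: of_real_mult exp_add)
      (simp_all add: algebra_simps)
  then have "?X = (1 / 4) *\<^sub>R (R 1 1 + R 1 (- 1) + R (- 1) 1 + R (- 1) (- 1))"
    by (simp add: vec_eq_iff)
  moreover have "separable_state (R e f)" for e f
    unfolding R_def v_def by (rule separable_rank_one_tensor3)
  ultimately show ?thesis
    by (simp add: separable_add separable_scaleR)
qed
text \<open>The sign in the last entry compensates the conjugate of \<open>c $ 4\<close> in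
  \<open>L_X\<close>, so that \<open>L_X\<close> on the torus is the trigonometric sum inside
  \<open>C_fun\<close>.\<close>

definition torus :: "real \<Rightarrow> real \<Rightarrow> real \<Rightarrow> complex ^ 4" where
  "torus \<alpha> \<beta> \<gamma> = vector [cis (\<alpha> + \<beta> + \<gamma>), cis \<alpha>, cis \<beta>, cis (- \<gamma>)]"

lemma le_Delta_X_iff:
  "d \<le> Delta_X a b \<longleftrightarrow>
     d \<le> sqrt (a $ 1 * b $ 1) \<and> d \<le> sqrt (a $ 2 * b $ 2) \<and>
     d \<le> sqrt (a $ 3 * b $ 3) \<and> d \<le> sqrt (a $ 4 * b $ 4) \<and>
     d \<le> root 4 (a $ 1 * b $ 2 * b $ 3 * a $ 4) \<and> d \<le> root 4 (b $ 1 * a $ 2 * a $ 3 * b $ 4)"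
  unfolding Delta_X_def by simp

lemma le_sqrt_iff:
  fixes x d :: real
  assumes "d \<ge> 0"
  shows "d \<le> sqrt x \<longleftrightarrow> d\<^sup>2 \<le> x"
  using assms real_sqrt_le_iff[of "d\<^sup>2" x] by simp

lemma le_root4_iff:
  fixes x d :: real
  assumes "d \<ge> 0"
  shows "d \<le> root 4 x \<longleftrightarrow> d ^ 4 \<le> x"
  using assms real_root_le_iff[of 4 "d ^ 4" x] by (simp add: real_root_power_cancel)

text \<open>
  The signature \<open>(+, -, -, +)\<close> of the exponents must sum to 0, which is the solvability condition for
  \<open>x\<close>, \<open>y\<close>, \<open>w\<close>; the two extreme choices give sums of opposite sign.
\<close>

lemma log_interpolation:
  fixes A1 A2 A3 A4 B1 B2 B3 B4 :: real
  assumes "A1 + B1 \<ge> 0" "A2 + B2 \<ge> 0" "A3 + B3 \<ge> 0" "A4 + B4 \<ge> 0"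
    and "A1 + B2 + B3 + A4 \<ge> 0" "B1 + A2 + A3 + B4 \<ge> 0"
  obtains x y w :: real where
    "x + y + w \<in> {- B1..A1}" "x + y - w \<in> {- B2..A2}"
    "x - y + w \<in> {- B3..A3}" "x - y - w \<in> {- B4..A4}"
proof -
  define S T where "S = A1 + B2 + B3 + A4" and "T = B1 + A2 + A3 + B4"
  \<comment> \<open>If S + T = 0, then both vanish, t is 0 by the convention for division, and
    \<open>t * (S + T) = T\<close> still holds.\<close>
  define t where "t = T / (S + T)"
  have "S \<ge> 0" "T \<ge> 0" using assms by (auto simp: S_def T_def)
  then have t: "0 \<le> t" "t \<le> 1" "t * (S + T) = T"
    by (auto simp: t_def divide_simps)
  \<comment> \<open>As t goes from 0 to 1, C1 and C4 rise through their intervals while C2 and C3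
    fall. The alternating sum C1 - C2 - C3 + C4 goes affinely from -T to S and vanishes at the
    chosen t.\<close>
  define C1 C2 C3 C4 where "C1 = t * (A1 + B1) - B1" and "C2 = A2 - t * (A2 + B2)"
    and "C3 = A3 - t * (A3 + B3)" and "C4 = t * (A4 + B4) - B4"
  have "C1 + C4 = C2 + C3"
    using t(3) by (simp add: C1_def C2_def C3_def C4_def S_def T_def algebra_simps)
  then have eq: "(C1 + C4) / 2 + (C1 - C3) / 2 + (C1 - C2) / 2 = C1"
    "(C1 + C4) / 2 + (C1 - C3) / 2 - (C1 - C2) / 2 = C2"
    "(C1 + C4) / 2 - (C1 - C3) / 2 + (C1 - C2) / 2 = C3"
    "(C1 + C4) / 2 - (C1 - C3) / 2 - (C1 - C2) / 2 = C4"
    by (simp_all add: field_simps)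
  have I: "0 \<le> t * r" "t * r \<le> r" if "r \<ge> 0" for r
    using t that by (simp_all add: mult_left_le_one_le)
  show ?thesis
  proof (rule that[of "(C1 + C4) / 2" "(C1 - C3) / 2" "(C1 - C2) / 2"], unfold eq)
    show "C1 \<in> {- B1..A1}" "C2 \<in> {- B2..A2}" "C3 \<in> {- B3..A3}" "C4 \<in> {- B4..A4}"
      using I[OF assms(1)] I[OF assms(2)] I[OF assms(3)] I[OF assms(4)]
      by (auto simp: C1_def C2_def C3_def C4_def)
  qed
qed

text \<open>Dividing the diagonal by d and taking logarithms turns the six inequalities behind
  \<open>d \<le> Delta_X a b\<close> into the hypotheses of \<open>log_interpolation\<close>. Its
  solution is a product diagonal that, scaled by d, lies below the given one; what is left over is a
  nonnegative diagonal matrix.\<close>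

lemma separable_X_torus:
  fixes a b :: "real ^ 4"
  assumes a: "\<And>i. a $ i \<ge> 0" and b: "\<And>i. b $ i \<ge> 0"
    and d: "d \<ge> 0" "d \<le> Delta_X a b"
  shows "separable_state (X_matrix a b (d *\<^sub>R torus \<alpha> \<beta> \<gamma>))"
proof (cases "d = 0")
  case True
  then show ?thesis using separable_X_diagonal[OF a b] by simp
next
  case False
  with d have "d > 0" by simp
  have sq: "d\<^sup>2 \<le> a $ i * b $ i" for i
    using d exhaust_4[of i] by (auto simp: le_Delta_X_iff le_sqrt_iff)
  have four: "d ^ 4 \<le> a $ 1 * b $ 2 * b $ 3 * a $ 4" "d ^ 4 \<le> b $ 1 * a $ 2 * a $ 3 * b $ 4"
    using d by (simp_all add: le_Delta_X_iff le_root4_iff)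
  have pos: "a $ i > 0" "b $ i > 0" for i
    using sq[of i] a[of i] b[of i] zero_less_power[OF \<open>d > 0\<close>, of 2]
    by (auto simp: less_le)
  then have nz: "a $ i \<noteq> 0" "b $ i \<noteq> 0" for i
    by (metis less_irrefl)+
  define A B where "A i = ln (a $ i / d)" and "B i = ln (b $ i / d)" for i
  have AB: "A i + B i \<ge> 0" for i
  proof -
    have "A i + B i = ln (a $ i * b $ i / d\<^sup>2)"
      using pos[of i] \<open>d > 0\<close> by (simp add: A_def B_def ln_mult ln_div ln_realpow)
    then show ?thesis using sq[of i] \<open>d > 0\<close> by simp
  qed
  have "A 1 + B 2 + B 3 + A 4 = ln (a $ 1 * b $ 2 * b $ 3 * a $ 4 / d ^ 4)"
    using pos nz \<open>d > 0\<close> by (simp add: A_def B_def ln_mult ln_div ln_realpow)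
  then have S: "A 1 + B 2 + B 3 + A 4 \<ge> 0" using four \<open>d > 0\<close> by simp
  have "B 1 + A 2 + A 3 + B 4 = ln (b $ 1 * a $ 2 * a $ 3 * b $ 4 / d ^ 4)"
    using pos nz \<open>d > 0\<close> by (simp add: A_def B_def ln_mult ln_div ln_realpow)
  then have T: "B 1 + A 2 + A 3 + B 4 \<ge> 0" using four \<open>d > 0\<close> by simp
  obtain x y w where xyw: "x + y + w \<in> {- B 1..A 1}" "x + y - w \<in> {- B 2..A 2}"
    "x - y + w \<in> {- B 3..A 3}" "x - y - w \<in> {- B 4..A 4}"
    using log_interpolation[OF AB AB AB AB S T] .
  have le: "d * exp s \<le> a $ i" "d * exp (- s) \<le> b $ i" if "s \<in> {- B i..A i}" for s i
  proof -
    have "exp s \<le> a $ i / d" "exp (- s) \<le> b $ i / d"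
      using that pos[of i] \<open>d > 0\<close> by (auto simp: A_def B_def simp flip: ln_ge_iff)
    then show "d * exp s \<le> a $ i" "d * exp (- s) \<le> b $ i"
      using \<open>d > 0\<close> by (simp_all add: field_simps)
  qed
  define a' :: "real ^ 4" where
    "a' = vector [exp (x + y + w), exp (x + y - w), exp (x - y + w), exp (x - y - w)]"
  define b' :: "real ^ 4" where
    "b' = vector [exp (- x - y - w), exp (- x - y + w), exp (- x + y - w), exp (- x + y + w)]"
  have "separable_state (X_matrix a' b' (torus \<alpha> \<beta> \<gamma>))"
  proof -
    \<comment> \<open>The phases of the three factors are found by solving for the four antidiagonal
      angles; the system is consistent because the first torus angle is the sum of the other
      parameters.\<close>
    define \<theta> \<phi> \<psi> where "\<theta> = (\<alpha> + \<beta>) / 2" and "\<phi> = (\<alpha> + \<gamma>) / 2" and "\<psi> = (\<beta> + \<gamma>) / 2"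
    have "\<theta> + \<phi> + \<psi> = \<alpha> + \<beta> + \<gamma>" "\<theta> + \<phi> - \<psi> = \<alpha>" "\<theta> - \<phi> + \<psi> = \<beta>" "\<theta> - \<phi> - \<psi> = - \<gamma>"
      by (simp_all add: \<theta>_def \<phi>_def \<psi>_def field_simps)
    then show ?thesis
      using separable_X_geometric[of x y w \<theta> \<phi> \<psi>] by (simp only: a'_def b'_def torus_def)
  qed
  moreover have "separable_state (X_matrix (a - d *\<^sub>R a') (b - d *\<^sub>R b') 0)"
  proof (rule separable_X_diagonal)
    show "(a - d *\<^sub>R a') $ i \<ge> 0" for i
      using exhaust_4[of i] le(1)[OF xyw(1)] le(1)[OF xyw(2)] le(1)[OF xyw(3)] le(1)[OF xyw(4)]
      by (auto simp: a'_def vector_4)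
    have neg: "- x - y - w = - (x + y + w)" "- x - y + w = - (x + y - w)"
      "- x + y - w = - (x - y + w)" "- x + y + w = - (x - y - w)" by simp_all
    show "(b - d *\<^sub>R b') $ i \<ge> 0" for i
      using exhaust_4[of i] le(2)[OF xyw(1)] le(2)[OF xyw(2)] le(2)[OF xyw(3)] le(2)[OF xyw(4)]
      unfolding b'_def neg by (auto simp: vector_4)
  qed
  moreover have "X_matrix a b (d *\<^sub>R torus \<alpha> \<beta> \<gamma>) =
      d *\<^sub>R X_matrix a' b' (torus \<alpha> \<beta> \<gamma>) + X_matrix (a - d *\<^sub>R a') (b - d *\<^sub>R b') 0"
    by (simp add: X_matrix_scaleR X_matrix_add)
  ultimately show ?thesis
    using \<open>d > 0\<close> by (simp add: separable_add separable_scaleR)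
qed

section \<open>The function C as a supremum over the torus\<close>

lemma L_X_torus:
  "L_X (torus \<alpha> \<beta> \<gamma>) z = Re (z $ 1) * cos (\<alpha> + \<beta> + \<gamma>) - Im (z $ 1) * sin (\<alpha> + \<beta> + \<gamma>)
      + Re (z $ 2) * cos \<alpha> - Im (z $ 2) * sin \<alpha>
      + Re (z $ 3) * cos \<beta> - Im (z $ 3) * sin \<beta>
      + Re (z $ 4) * cos \<gamma> - Im (z $ 4) * sin \<gamma>"
  by (simp add: L_X_def torus_def vector_4)

lemma C_fun_eq: "C_fun z = (SUP (\<alpha>, \<beta>, \<gamma>). \<bar>L_X (torus \<alpha> \<beta> \<gamma>) z\<bar>)"
  by (simp add: C_fun_def L_X_torus)

text \<open>A real supremum dominates its members once the family is bounded above; the sum of the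
  moduli of z is such a bound.\<close>

lemma L_X_torus_le_C_fun: "\<bar>L_X (torus \<alpha> \<beta> \<gamma>) z\<bar> \<le> C_fun z"
proof -
  have bound: "\<bar>L_X (torus \<alpha> \<beta> \<gamma>) z\<bar> \<le> cmod (z $ 1) + cmod (z $ 2) + cmod (z $ 3) + cmod (z $ 4)" for \<alpha> \<beta> \<gamma>
  proof -
    have "\<bar>Re (u * cis t)\<bar> \<le> cmod u" for u t
      using abs_Re_le_cmod[of "u * cis t"] by (simp add: norm_mult)
    from this[of "z $ 1" "\<alpha> + \<beta> + \<gamma>"] this[of "z $ 2" \<alpha>] this[of "z $ 3" \<beta>] this[of "z $ 4" \<gamma>]
    show ?thesis
      unfolding L_X_torus by simp
  qed
  then have "bdd_above (range (\<lambda>(\<alpha>, \<beta>, \<gamma>). \<bar>L_X (torus \<alpha> \<beta> \<gamma>) z\<bar>))"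
    by (intro bdd_aboveI2[where M = "cmod (z $ 1) + cmod (z $ 2) + cmod (z $ 3) + cmod (z $ 4)"]) auto
  from cSUP_upper[OF _ this, of "(\<alpha>, \<beta>, \<gamma>)"] show ?thesis
    by (simp add: C_fun_eq)
qed

text \<open>The angle sum shifts by 3 pi, an odd multiple of pi, so all four torus entries change
  sign. Hence a one-sided bound on the whole torus also bounds the absolute value.\<close>

lemma L_X_torus_antipode: "L_X (torus (\<alpha> + pi) (\<beta> + pi) (\<gamma> + pi)) z = - L_X (torus \<alpha> \<beta> \<gamma>) z"
proof -
  have "\<alpha> + pi + (\<beta> + pi) + (\<gamma> + pi) = (\<alpha> + \<beta> + \<gamma> + pi) + 2 * pi" by simp
  then have "cos (\<alpha> + pi + (\<beta> + pi) + (\<gamma> + pi)) = - cos (\<alpha> + \<beta> + \<gamma>)"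
    "sin (\<alpha> + pi + (\<beta> + pi) + (\<gamma> + pi)) = - sin (\<alpha> + \<beta> + \<gamma>)"
    by (simp_all only: cos_periodic sin_periodic cos_periodic_pi sin_periodic_pi)
  then show ?thesis unfolding L_X_torus by simp
qed

lemma C_fun_least:
  assumes "\<And>\<alpha> \<beta> \<gamma>. L_X (torus \<alpha> \<beta> \<gamma>) z \<le> M"
  shows "C_fun z \<le> M"
proof -
  have "\<bar>L_X (torus \<alpha> \<beta> \<gamma>) z\<bar> \<le> M" for \<alpha> \<beta> \<gamma>
    using assms[of \<alpha> \<beta> \<gamma>] assms[of "\<alpha> + pi" "\<beta> + pi" "\<gamma> + pi"] by (simp add: L_X_torus_antipode)
  then show ?thesis
    unfolding C_fun_eq by (intro cSUP_least) auto
qed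

section \<open>Linearity of the functional, and sufficiency by separation\<close>

lemma L_X_scaleR: "L_X (r *\<^sub>R c) z = r * L_X c z"
  by (simp add: L_X_def algebra_simps)

lemma L_X_sum: "L_X (\<Sum>l\<in>I. c l) z = (\<Sum>l\<in>I. L_X (c l) z)"
proof (induction I rule: infinite_finite_induct)
  case (insert l I)
  have "L_X (u + v) z = L_X u z + L_X v z" for u v
    by (simp add: L_X_def algebra_simps)
  with insert show ?case by simp
qed (simp_all add: L_X_def)

text \<open>Translates a separating hyperplane, given by a real inner product, into a parameter z.
  The last entry of y stays unconjugated because \<open>L_X\<close> already conjugates
  \<open>c $ 4\<close>.\<close>

lemma inner_eq_L_X: "inner y c = L_X c (vector [cnj (y $ 1), cnj (y $ 2), cnj (y $ 3), y $ 4])"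
  by (simp add: inner_vec_def sum_4 inner_complex_def L_X_def vector_4)

lemma compact_torus: "compact (range (\<lambda>(\<alpha>, \<beta>, \<gamma>). torus \<alpha> \<beta> \<gamma>))"
proof -
  \<comment> \<open>The angles range over a noncompact space, so the torus is rewritten as a
    continuous image of three unit circles.\<close>
  define f :: "complex \<times> complex \<times> complex \<Rightarrow> complex ^ 4"
    where "f = (\<lambda>(p, q, r). vector [p * q * r, p, q, cnj r])"
  let ?K = "sphere (0::complex) 1 \<times> sphere (0::complex) 1 \<times> sphere (0::complex) 1"
  have "continuous_on ?K (\<lambda>x. f x $ i)" for i
    using exhaust_4[of i] unfolding f_def case_prod_beta
    by (elim disjE) (auto simp: vector_4 intro!: continuous_intros)
  then have "continuous_on ?K (\<lambda>x. \<chi> i. f x $ i)"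
    by (rule continuous_on_vec_lambda)
  then have "compact (f ` ?K)"
    by (intro compact_continuous_image compact_Times compact_sphere) simp
  moreover have "f ` ?K = range (\<lambda>(\<alpha>, \<beta>, \<gamma>). torus \<alpha> \<beta> \<gamma>)"
  proof (intro equalityI subsetI)
    fix v assume "v \<in> f ` ?K"
    then obtain p q r where v: "v = f (p, q, r)" "cmod p = 1" "cmod q = 1" "cmod r = 1" by auto
    then have "cis (Arg p) = p" "cis (Arg q) = q" "cis (Arg r) = r"
      using rcis_cmod_Arg[of p] rcis_cmod_Arg[of q] rcis_cmod_Arg[of r] by (simp_all add: rcis_def)
    then have "v = torus (Arg p) (Arg q) (Arg r)"
      by (simp add: v f_def torus_def flip: cis_mult cis_cnj)
    then show "v \<in> range (\<lambda>(\<alpha>, \<beta>, \<gamma>). torus \<alpha> \<beta> \<gamma>)"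
      by (intro range_eqI[of _ _ "(Arg p, Arg q, Arg r)"]) simp
  next
    fix v assume "v \<in> range (\<lambda>(\<alpha>, \<beta>, \<gamma>). torus \<alpha> \<beta> \<gamma>)"
    then obtain \<alpha> \<beta> \<gamma> where "v = torus \<alpha> \<beta> \<gamma>" by auto
    then have "v = f (cis \<alpha>, cis \<beta>, cis \<gamma>)"
      by (simp add: f_def torus_def cis_mult cis_cnj)
    then show "v \<in> f ` ?K"
      by (intro image_eqI[of _ _ "(cis \<alpha>, cis \<beta>, cis \<gamma>)"]) simp_all
  qed
  ultimately show ?thesis by simp
qed

lemma separable_X_if_le_C_fun:
  fixes a b :: "real ^ 4"
  assumes a: "\<And>i. a $ i \<ge> 0" and b: "\<And>i. b $ i \<ge> 0"
    and C: "\<And>z. L_X c z \<le> C_fun z * Delta_X a b"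
  shows "separable_state (X_matrix a b c)"
proof -
  define d where "d = Delta_X a b"
  have "d \<ge> 0"
    using a b by (simp add: d_def le_Delta_X_iff)
  define T where "T = (*\<^sub>R) d ` range (\<lambda>(\<alpha>, \<beta>, \<gamma>). torus \<alpha> \<beta> \<gamma>)"
  have "c \<in> convex hull T"
  proof (rule ccontr)
    assume "c \<notin> convex hull T"
    moreover have "closed (convex hull T)"
      unfolding T_def by (intro compact_imp_closed compact_convex_hull compact_scaling compact_torus)
    ultimately obtain y M where y: "inner y c < M" "\<And>x. x \<in> convex hull T \<Longrightarrow> inner y x > M"
      using separating_hyperplane_closed_point[of "convex hull T" c] by auto
    \<comment> \<open>The hyperplane has c on its lower side. Negating y turns this into an upper
      bound -M on T that c exceeds, contrary to the assumed inequality at z.\<close>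
    define z :: "complex ^ 4" where "z = vector [cnj ((- y) $ 1), cnj ((- y) $ 2), cnj ((- y) $ 3), (- y) $ 4]"
    have z: "L_X v z = - inner y v" for v
      using inner_eq_L_X[of "- y" v] by (simp add: z_def)
    have T: "d * L_X (torus \<alpha> \<beta> \<gamma>) z < - M" for \<alpha> \<beta> \<gamma>
    proof -
      have "d *\<^sub>R torus \<alpha> \<beta> \<gamma> \<in> T"
        unfolding T_def by (intro imageI range_eqI[of _ _ "(\<alpha>, \<beta>, \<gamma>)"]) simp
      then have "inner y (d *\<^sub>R torus \<alpha> \<beta> \<gamma>) > M" by (intro y(2) hull_inc)
      then show ?thesis by (simp add: z)
    qed
    have "C_fun z * d \<le> - M"
    \<comment> \<open>For d = 0 the set T is the origin alone, and separation from c just says 0 <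
      -M.\<close>
    proof (cases "d = 0")
      case True
      with T[of 0 0 0] show ?thesis by simp
    next
      case False
      with \<open>d \<ge> 0\<close> have "L_X (torus \<alpha> \<beta> \<gamma>) z \<le> - M / d" for \<alpha> \<beta> \<gamma>
        using less_imp_le[OF T[of \<alpha> \<beta> \<gamma>]] by (simp add: field_simps)
      then have "C_fun z \<le> - M / d" by (rule C_fun_least)
      with False \<open>d \<ge> 0\<close> show ?thesis by (simp add: field_simps)
    qed
    with y(1) C[of z] show False by (simp add: z d_def)
  qed
  moreover have "convex hull T \<subseteq> {c. separable_state (X_matrix a b c)}"
  proof (rule hull_minimal)
    show "T \<subseteq> {c. separable_state (X_matrix a b c)}"
      using separable_X_torus[OF a b \<open>d \<ge> 0\<close>] by (auto simp: T_def d_def)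
    show "convex {c. separable_state (X_matrix a b c)}"
    proof (rule convexI, unfold mem_Collect_eq)
      fix u v and s t :: real
      assume uv: "separable_state (X_matrix a b u)" "separable_state (X_matrix a b v)"
        and st: "0 \<le> s" "0 \<le> t" "s + t = 1"
      have "X_matrix a b (s *\<^sub>R u + t *\<^sub>R v) = s *\<^sub>R X_matrix a b u + t *\<^sub>R X_matrix a b v"
        using st(3) by (simp add: X_matrix_scaleR X_matrix_add flip: scaleR_add_left)
      then show "separable_state (X_matrix a b (s *\<^sub>R u + t *\<^sub>R v))"
        using uv st by (simp add: separable_add separable_scaleR)
    qed
  qed
  ultimately show ?thesis by auto
qed

section \<open>Cauchy-Schwarz inequalities for two and four families\<close>

lemma sum_power2_le:
  fixes f g h :: "'i \<Rightarrow> real"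
  assumes "\<And>l. l \<in> I \<Longrightarrow> 0 \<le> f l" "\<And>l. l \<in> I \<Longrightarrow> 0 \<le> g l" "\<And>l. l \<in> I \<Longrightarrow> 0 \<le> h l"
    and "\<And>l. l \<in> I \<Longrightarrow> (h l)\<^sup>2 \<le> f l * g l"
  shows "(\<Sum>l\<in>I. h l)\<^sup>2 \<le> (\<Sum>l\<in>I. f l) * (\<Sum>l\<in>I. g l)"
proof -
  have "h l \<le> sqrt (f l) * sqrt (g l)" if "l \<in> I" for l
    using assms(4)[OF that] by (simp add: real_le_rsqrt flip: real_sqrt_mult)
  then have "(\<Sum>l\<in>I. h l)\<^sup>2 \<le> (\<Sum>l\<in>I. sqrt (f l) * sqrt (g l))\<^sup>2"
    using assms(3) by (intro power_mono sum_mono sum_nonneg)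
  also have "\<dots> \<le> (\<Sum>l\<in>I. (sqrt (f l))\<^sup>2) * (\<Sum>l\<in>I. (sqrt (g l))\<^sup>2)"
    by (rule Cauchy_Schwarz_ineq_sum)
  finally show ?thesis using assms(1,2) by simp
qed

text \<open>Cauchy-Schwarz is used twice: first for the geometric means u and v of the pairs (f, g)
  and (k, m), then inside each pair.\<close>

lemma sum_power4_le:
  fixes f g h k m :: "'i \<Rightarrow> real"
  assumes "\<And>l. l \<in> I \<Longrightarrow> 0 \<le> f l" "\<And>l. l \<in> I \<Longrightarrow> 0 \<le> g l" "\<And>l. l \<in> I \<Longrightarrow> 0 \<le> h l"
    "\<And>l. l \<in> I \<Longrightarrow> 0 \<le> k l" "\<And>l. l \<in> I \<Longrightarrow> 0 \<le> m l"
    and "\<And>l. l \<in> I \<Longrightarrow> h l ^ 4 \<le> f l * g l * k l * m l"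
  shows "(\<Sum>l\<in>I. h l) ^ 4 \<le> (\<Sum>l\<in>I. f l) * (\<Sum>l\<in>I. g l) * (\<Sum>l\<in>I. k l) * (\<Sum>l\<in>I. m l)"
proof -
  define u v where "u l = sqrt (f l * g l)" and "v l = sqrt (k l * m l)" for l
  have uv: "0 \<le> u l" "0 \<le> v l" "(u l)\<^sup>2 = f l * g l" "(v l)\<^sup>2 = k l * m l" if "l \<in> I" for l
    using assms(1,2,4,5)[OF that] by (simp_all add: u_def v_def)
  have "(h l)\<^sup>2 \<le> u l * v l" if "l \<in> I" for l
  proof (rule power2_le_imp_le)
    show "((h l)\<^sup>2)\<^sup>2 \<le> (u l * v l)\<^sup>2"
      using assms(6)[OF that] uv[OF that] by (simp add: power_mult_distrib mult.assoc)
  qed (simp add: uv[OF that])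
  then have "(\<Sum>l\<in>I. h l)\<^sup>2 \<le> (\<Sum>l\<in>I. u l) * (\<Sum>l\<in>I. v l)"
    using assms(3) uv(1,2) by (intro sum_power2_le)
  then have "((\<Sum>l\<in>I. h l)\<^sup>2)\<^sup>2 \<le> ((\<Sum>l\<in>I. u l) * (\<Sum>l\<in>I. v l))\<^sup>2"
    by (intro power_mono) simp_all
  also have "\<dots> = (\<Sum>l\<in>I. u l)\<^sup>2 * (\<Sum>l\<in>I. v l)\<^sup>2"
    by (simp add: power_mult_distrib)
  also have "\<dots> \<le> ((\<Sum>l\<in>I. f l) * (\<Sum>l\<in>I. g l)) * ((\<Sum>l\<in>I. k l) * (\<Sum>l\<in>I. m l))"
    using assms uv by (intro mult_mono sum_power2_le mult_nonneg_nonneg sum_nonneg) simp_all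
  finally show ?thesis by (simp add: mult.assoc)
qed


section \<open>Diagonal and antidiagonal of product states, and necessity\<close>

abbreviation diag_entry :: "cmat8 \<Rightarrow> qubit3 \<Rightarrow> real" where
  "diag_entry A p \<equiv> Re (A $ p $ p)"

definition antidiag :: "cmat8 \<Rightarrow> complex ^ 4" where
  "antidiag A = vector [A $ (0,0,0) $ (1,1,1), A $ (0,0,1) $ (1,1,0), A $ (0,1,0) $ (1,0,1), A $ (0,1,1) $ (1,0,0)]"

lemma antidiag_sum: "antidiag (\<Sum>l\<in>I. A l) = (\<Sum>l\<in>I. antidiag (A l))"
  by (simp add: antidiag_def vec_eq_iff forall_4 vector_4)

text \<open>Here \<open>1 - i\<close> is the flipped bit, and \<open>s\<close> is the common modulus of the antidiagonal entries of a product vector.\<close>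

definition product_profile :: "cmat8 \<Rightarrow> real \<Rightarrow> complex ^ 4 \<Rightarrow> bool" where
  "product_profile A s t \<longleftrightarrow> 0 \<le> s \<and> t \<in> range (\<lambda>(\<alpha>, \<beta>, \<gamma>). torus \<alpha> \<beta> \<gamma>) \<and>
     antidiag A = s *\<^sub>R t \<and> (\<forall>p. 0 \<le> diag_entry A p) \<and>
     (\<forall>i j k. s\<^sup>2 = diag_entry A (i, j, k) * diag_entry A (1 - i, 1 - j, 1 - k)) \<and>
     (\<forall>i j k. s ^ 4 = diag_entry A (i, j, k) * diag_entry A (1 - i, 1 - j, k) *
        diag_entry A (1 - i, j, 1 - k) * diag_entry A (i, 1 - j, 1 - k))"

text \<open>Entries factor over the three qubits, and each antidiagonal entry uses both coordinates
  of every factor, hence the common modulus s. In the product of two opposite diagonal entries every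
  coordinate modulus occurs squared; in the four-term product each bit takes each value twice,
  giving fourth powers.\<close>

lemma pure_product_state_profile:
  assumes "pure_product_state A"
  shows "\<exists>s t. product_profile A s t"
proof -
  obtain r x y w where r: "r > 0" and A: "A = r *\<^sub>R rank_one (tensor3 x y w)"
    using assms by (rule pure_product_stateE)
  define \<theta> \<phi> \<psi> where "\<theta> = Arg (x $ 0 * cnj (x $ 1))" and "\<phi> = Arg (y $ 0 * cnj (y $ 1))"
    and "\<psi> = Arg (w $ 0 * cnj (w $ 1))"
  define X0 X1 Y0 Y1 W0 W1 where "X0 = cmod (x $ 0)" and "X1 = cmod (x $ 1)"
    and "Y0 = cmod (y $ 0)" and "Y1 = cmod (y $ 1)" and "W0 = cmod (w $ 0)" and "W1 = cmod (w $ 1)"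
  define s where "s = r * (X0 * X1) * (Y0 * Y1) * (W0 * W1)"
  have off: "x $ 0 * cnj (x $ 1) = of_real (X0 * X1) * cis \<theta>" "y $ 0 * cnj (y $ 1) = of_real (Y0 * Y1) * cis \<phi>"
    "w $ 0 * cnj (w $ 1) = of_real (W0 * W1) * cis \<psi>"
    using rcis_cmod_Arg[of "x $ 0 * cnj (x $ 1)"] rcis_cmod_Arg[of "y $ 0 * cnj (y $ 1)"]
      rcis_cmod_Arg[of "w $ 0 * cnj (w $ 1)"]
    by (simp_all add: rcis_def norm_mult \<theta>_def \<phi>_def \<psi>_def X0_def X1_def Y0_def Y1_def W0_def W1_def)
  have off': "x $ 1 * cnj (x $ 0) = of_real (X0 * X1) * cis (- \<theta>)" "y $ 1 * cnj (y $ 0) = of_real (Y0 * Y1) * cis (- \<phi>)"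
    "w $ 1 * cnj (w $ 0) = of_real (W0 * W1) * cis (- \<psi>)"
    using off[THEN arg_cong[where f = cnj]] by (simp_all add: cis_cnj mult.commute)
  have entry: "A $ (i, j, k) $ (i', j', k') = of_real r *
      ((x $ i * cnj (x $ i')) * (y $ j * cnj (y $ j')) * (w $ k * cnj (w $ k')))" for i j k i' j' k'
    by (simp add: A rank_one_tensor3 scaleR_conv_of_real[where 'a = complex])
  have diag: "Re (A $ (i, j, k) $ (i, j, k)) = r * (cmod (x $ i))\<^sup>2 * (cmod (y $ j))\<^sup>2 * (cmod (w $ k))\<^sup>2" for i j k
    unfolding entry complex_norm_square[symmetric] by (simp flip: of_real_mult of_real_power)
  have "Re (A $ p $ p) \<ge> 0" for p
    using r by (cases p) (simp add: diag)
  moreover have "s \<ge> 0"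
    using r by (simp add: s_def X0_def X1_def Y0_def Y1_def W0_def W1_def)
  \<comment> \<open>The second and third angles are read off the entries; the third parameter is the
    negated fourth angle. Their sum is then the phase of the corner entry.\<close>
  moreover have "antidiag A = s *\<^sub>R torus (\<theta> + \<phi> - \<psi>) (\<theta> - \<phi> + \<psi>) (- \<theta> + \<phi> + \<psi>)"
  proof -
    have angles: "\<theta> + \<phi> - \<psi> + (\<theta> - \<phi> + \<psi>) + (- \<theta> + \<phi> + \<psi>) = \<theta> + \<phi> + \<psi>"
      "- (- \<theta> + \<phi> + \<psi>) = \<theta> - \<phi> - \<psi>" by simp_all
    have cis: "cis (\<theta> + \<phi> + \<psi>) = cis \<theta> * cis \<phi> * cis \<psi>"
      "cis (\<theta> + \<phi> - \<psi>) = cis \<theta> * cis \<phi> * cis (- \<psi>)"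
      "cis (\<theta> - \<phi> + \<psi>) = cis \<theta> * cis (- \<phi>) * cis \<psi>"
      "cis (\<theta> - \<phi> - \<psi>) = cis \<theta> * cis (- \<phi>) * cis (- \<psi>)"
      by (simp_all add: cis_mult)
    have "A $ (0,0,0) $ (1,1,1) = of_real s * cis (\<theta> + \<phi> + \<psi>)"
      "A $ (0,0,1) $ (1,1,0) = of_real s * cis (\<theta> + \<phi> - \<psi>)"
      "A $ (0,1,0) $ (1,0,1) = of_real s * cis (\<theta> - \<phi> + \<psi>)"
      "A $ (0,1,1) $ (1,0,0) = of_real s * cis (\<theta> - \<phi> - \<psi>)"
      unfolding entry off off' cis s_def by simp_all
    then show ?thesis
      by (simp add: antidiag_def vec_eq_iff forall_4 vector_4 torus_def angles add.assoc scaleR_conv_of_real[where 'a = complex])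
  qed
  moreover have "s\<^sup>2 = diag_entry A (i, j, k) * diag_entry A (1 - i, 1 - j, 1 - k)"
    "s ^ 4 = diag_entry A (i, j, k) * diag_entry A (1 - i, 1 - j, k) *
        diag_entry A (1 - i, j, 1 - k) * diag_entry A (i, 1 - j, 1 - k)" for i j k
  proof -
    have flip: "cmod (v $ 0) * cmod (v $ 1) = cmod (v $ i) * cmod (v $ (1 - i))" for v :: "complex ^ 2" and i
      using bit_cases[of i] by (elim disjE) simp_all
    have s: "s = r * (cmod (x $ i) * cmod (x $ (1 - i))) * (cmod (y $ j) * cmod (y $ (1 - j))) *
        (cmod (w $ k) * cmod (w $ (1 - k)))"
      unfolding s_def X0_def X1_def Y0_def Y1_def W0_def W1_def flip[of x i] flip[of y j] flip[of w k] ..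
    show "s\<^sup>2 = diag_entry A (i, j, k) * diag_entry A (1 - i, 1 - j, 1 - k)"
      unfolding diag s by algebra
    show "s ^ 4 = diag_entry A (i, j, k) * diag_entry A (1 - i, 1 - j, k) *
        diag_entry A (1 - i, j, 1 - k) * diag_entry A (i, 1 - j, 1 - k)"
      unfolding diag s by algebra
  qed
  moreover have "torus \<alpha> \<beta> \<gamma> \<in> range (\<lambda>(\<alpha>, \<beta>, \<gamma>). torus \<alpha> \<beta> \<gamma>)" for \<alpha> \<beta> \<gamma>
    by (rule range_eqI[of _ _ "(\<alpha>, \<beta>, \<gamma>)"]) simp
  ultimately have "product_profile A s (torus (\<theta> + \<phi> - \<psi>) (\<theta> - \<phi> + \<psi>) (- \<theta> + \<phi> + \<psi>))"
    unfolding product_profile_def by (intro conjI allI)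
  then show ?thesis by blast
qed

lemma X_matrix_entries:
  "X_matrix a b c $ (0,0,0) $ (0,0,0) = of_real (a $ 1)" "X_matrix a b c $ (0,0,1) $ (0,0,1) = of_real (a $ 2)"
  "X_matrix a b c $ (0,1,0) $ (0,1,0) = of_real (a $ 3)" "X_matrix a b c $ (0,1,1) $ (0,1,1) = of_real (a $ 4)"
  "X_matrix a b c $ (1,0,0) $ (1,0,0) = of_real (b $ 4)" "X_matrix a b c $ (1,0,1) $ (1,0,1) = of_real (b $ 3)"
  "X_matrix a b c $ (1,1,0) $ (1,1,0) = of_real (b $ 2)" "X_matrix a b c $ (1,1,1) $ (1,1,1) = of_real (b $ 1)"
  "X_matrix a b c $ (0,0,0) $ (1,1,1) = c $ 1" "X_matrix a b c $ (0,0,1) $ (1,1,0) = c $ 2"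
  "X_matrix a b c $ (0,1,0) $ (1,0,1) = c $ 3" "X_matrix a b c $ (0,1,1) $ (1,0,0) = c $ 4"
  by (simp_all add: X_matrix_def lex_pos_def)

text \<open>The pure summands need not be X-matrices. Comparing just the diagonals and antidiagonals
  writes c as a sum of torus points with weights \<open>s l\<close>, whose total S is at most
  \<open>Delta_X a b\<close>.\<close>

lemma le_C_fun_if_separable_X:
  assumes "separable_state (X_matrix a b c)"
  shows "L_X c z \<le> C_fun z * Delta_X a b"
proof -
  obtain n :: nat and A where A: "\<forall>l<n. pure_product_state (A l)" "X_matrix a b c = (\<Sum>l<n. A l)"
    using assms by (rule separable_stateE)
  have "\<forall>l. \<exists>s t. l < n \<longrightarrow> product_profile (A l) s t"
    using A(1) pure_product_state_profile by simp
  then obtain s t where "\<And>l. l < n \<Longrightarrow> product_profile (A l) (s l) (t l)" by metis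
  note P = this[unfolded product_profile_def]
  have s: "s l \<ge> 0" if "l < n" for l
    using P[OF that] by blast
  have D: "diag_entry (A l) p \<ge> 0" if "l < n" for l p
    using P[OF that] by blast
  define S where "S = (\<Sum>l<n. s l)"
  have "S \<ge> 0" using s by (auto simp: S_def intro!: sum_nonneg)
  have sum_diag: "(\<Sum>l<n. diag_entry (A l) p) = diag_entry (X_matrix a b c) p" for p
    by (simp add: A(2))
  have sq: "S\<^sup>2 \<le> diag_entry (X_matrix a b c) (i, j, k) * diag_entry (X_matrix a b c) (1 - i, 1 - j, 1 - k)"
    for i j k
    unfolding S_def sum_diag[symmetric]
  proof (rule sum_power2_le)
    show "(s l)\<^sup>2 \<le> diag_entry (A l) (i, j, k) * diag_entry (A l) (1 - i, 1 - j, 1 - k)"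
      if "l \<in> {..<n}" for l
      using P[of l] that by (metis lessThan_iff order_refl)
  qed (simp_all add: s D)
  have four: "S ^ 4 \<le> diag_entry (X_matrix a b c) (i, j, k) * diag_entry (X_matrix a b c) (1 - i, 1 - j, k) *
      diag_entry (X_matrix a b c) (1 - i, j, 1 - k) * diag_entry (X_matrix a b c) (i, 1 - j, 1 - k)"
    for i j k
    unfolding S_def sum_diag[symmetric]
  proof (rule sum_power4_le)
    show "s l ^ 4 \<le> diag_entry (A l) (i, j, k) * diag_entry (A l) (1 - i, 1 - j, k) *
        diag_entry (A l) (1 - i, j, 1 - k) * diag_entry (A l) (i, 1 - j, 1 - k)"
      if "l \<in> {..<n}" for l
      using P[of l] that by (metis lessThan_iff order_refl)
  qed (simp_all add: s D)
  \<comment> \<open>The two fourth roots come from the index triples of even and of odd parity: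
    \<open>four[of 0 0 0]\<close> collects a1, b2, b3, a4, and \<open>four[of 1 1 1]\<close>
    collects b1, a2, a3, b4.\<close>
  have "S \<le> Delta_X a b"
    unfolding le_Delta_X_iff le_sqrt_iff[OF \<open>S \<ge> 0\<close>] le_root4_iff[OF \<open>S \<ge> 0\<close>]
    using sq[of 0 0 0] sq[of 0 0 1] sq[of 0 1 0] sq[of 0 1 1] four[of 0 0 0] four[of 1 1 1]
    by (simp add: X_matrix_entries mult_ac)
  have "c = antidiag (X_matrix a b c)"
    by (simp add: antidiag_def X_matrix_entries vec_eq_iff forall_4 vector_4)
  also have "\<dots> = (\<Sum>l<n. antidiag (A l))"
    by (simp only: A(2) antidiag_sum)
  also have "\<dots> = (\<Sum>l<n. s l *\<^sub>R t l)"
    using P by (intro sum.cong) auto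
  finally have "L_X c z = (\<Sum>l<n. s l * L_X (t l) z)"
    by (simp add: L_X_sum L_X_scaleR)
  also have "\<dots> \<le> (\<Sum>l<n. s l * C_fun z)"
  proof (intro sum_mono mult_left_mono)
    fix l assume "l \<in> {..<n}"
    with P[of l] obtain \<alpha> \<beta> \<gamma> where "s l \<ge> 0" "t l = torus \<alpha> \<beta> \<gamma>" by auto
    then show "s l \<ge> 0" "L_X (t l) z \<le> C_fun z"
      using L_X_torus_le_C_fun[of \<alpha> \<beta> \<gamma> z] by simp_all
  qed
  also have "\<dots> = C_fun z * S"
    by (simp add: S_def sum_distrib_left mult.commute)
  \<comment> \<open>Monotonicity needs \<open>C_fun z\<close> to be nonnegative, which holds since
    it dominates an absolute value.\<close>
  also have "\<dots> \<le> C_fun z * Delta_X a b"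
    using \<open>S \<le> Delta_X a b\<close> L_X_torus_le_C_fun[of 0 0 0 z] by (intro mult_left_mono) simp_all
  finally show ?thesis .
qed

section \<open>Nonnegative diagonals of states and the equivalence\<close>

lemma positive_semidefinite_diagonal:
  fixes A :: "complex ^ 'n ^ 'n"
  assumes "positive_semidefinite A"
  shows "Re (A $ p $ p) \<ge> 0"
proof -
  have "(A *v axis p 1) $ q = A $ q $ p" for q
    by (simp add: matrix_vector_mult_def axis_def if_distrib cong: if_cong)
  then have "(\<Sum>q\<in>UNIV. cnj (axis p 1 $ q) * (A *v axis p 1) $ q) = (\<Sum>q\<in>UNIV. if q = p then A $ p $ p else 0)"
    by (intro sum.cong) (auto simp: axis_def)
  then have "(\<Sum>q\<in>UNIV. cnj (axis p 1 $ q) * (A *v axis p 1) $ q) = A $ p $ p" by simp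
  then show ?thesis
    using assms unfolding positive_semidefinite_def by metis
qed

theorem theorem2p1:
  fixes a b :: "real ^ 4" and c :: "complex ^ 4"
  assumes "three_qubit_state (X_matrix a b c)"
  shows "separable_state (X_matrix a b c) \<longleftrightarrow>
           (\<forall>z :: complex ^ 4. C_fun z * Delta_X a b \<ge> L_X c z)"
proof
  assume "separable_state (X_matrix a b c)"
  then show "\<forall>z. C_fun z * Delta_X a b \<ge> L_X c z"
    using le_C_fun_if_separable_X by blast
next
  assume C: "\<forall>z. C_fun z * Delta_X a b \<ge> L_X c z"
  have diag: "Re (X_matrix a b c $ p $ p) \<ge> 0" for p
    using assms unfolding three_qubit_state_def by (rule positive_semidefinite_diagonal)
  have "a $ i \<ge> 0" "b $ i \<ge> 0" for i
    using exhaust_4[of i] diag[of "(0,0,0)"] diag[of "(0,0,1)"] diag[of "(0,1,0)"] diag[of "(0,1,1)"]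
      diag[of "(1,1,1)"] diag[of "(1,1,0)"] diag[of "(1,0,1)"] diag[of "(1,0,0)"]
    by (auto simp: X_matrix_entries)
  then show "separable_state (X_matrix a b c)"
    using C by (intro separable_X_if_le_C_fun) simp_all
qed

end
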